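(* Let $\mathcal G$ be a compact, connected, finite metric graph with vertex set $\mathsf V$, non-empty set of Dirichlet vertices $\mathsf V_{\mathrm D}\subset\mathsf V$, and $\mathsf V_{\mathrm N}=\mathsf V\setminus\mathsf V_{\mathrm D}$. Then the following assertions hold. (1) [Gluing vertices] If $\widetilde{\mathcal G}$ is obtained from $\mathcal G$ by gluing two different vertices $\mathsf v\ne\mathsf w$ in $\mathsf V_{\mathrm N}$, then $T(\widetilde{\mathcal G};\mathsf V_{\mathrm D})\le T(\mathcal G;\mathsf V_{\mathrm D})$, with equality if and only if the torsion function $v$ of $\mathcal G$ satisfies $v(\mathsf v)=v(\mathsf w)$. (2) [Imposing Dirichlet conditions on additional vertices] If $\mathsf v\in\mathsf V$, $\mathsf v\notin\mathsf V_{\mathrm D}$, then $T(\mathcal G;\mathsf V_{\mathrm D}\cup\{\mathsf v\})<T(\mathcal G;\mathsf V_{\mathrm D})$. (3) [Attaching pendant graphs with no Dirichlet vertices] If $\widetilde{\mathcal G}$ is formed by attaching a pendant graph $\widetilde{\mathcal G}\setminus\mathcal G$ at only one vertex $\mathsf v\in\mathsf V_{\mathrm N}$ of $\mathcal G$, and no Dirichlet conditions are imposed on $\widetilde{\mathcal G}\setminus\mathcal G$, then $T(\mathcal G)\le T(\widetilde{\mathcal G})$. (4) [Adding edges between points where the torsion function attains the same value] If $\widetilde{\mathcal G}$ is obtained from $\mathcal G$ by adding an edge between two vertices $\mathsf v',\mathsf v''$ of $\mathcal G$, then $T(\mathcal G)\le T(\widetilde{\mathcal G})$ provided the torsion function of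 $\mathcal G$ attains the same value at $\mathsf v'$ and $\mathsf v''$. (5) [Lengthening edges] If $\widetilde{\mathcal G}$ is obtained from $\mathcal G$ by lengthening one edge, then $T(\mathcal G)<T(\widetilde{\mathcal G})$. (6) [Scaling the whole graph] If $\widetilde{\mathcal G}$ is obtained from $\mathcal G$ by scaling each edge with the factor $c>0$, then $T(\mathcal G)=c^{-3}T(\widetilde{\mathcal G})$. (7) [Unfolding parallel edges] Let $\mathsf e_1,\mathsf e_2$ be two parallel edges with common endpoints $\mathsf v_1,\mathsf v_2\in\mathsf V$. If $\widetilde{\mathcal G}$ is obtained from $\mathcal G$ by replacing $\mathsf e_1,\mathsf e_2$ with a single edge $\mathsf e_0$ (with endpoints $\mathsf v_1,\mathsf v_2$) of length $\ell_{\mathsf e_0}=\ell_{\mathsf e_1}+\ell_{\mathsf e_2}$, then $T(\widetilde{\mathcal G})>T(\mathcal G)$.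
   Context: A compact, connected, finite metric graph consists of finitely many edges $\mathsf e\simeq[0,\ell_{\mathsf e}]$, $0<\ell_{\mathsf e}<\infty$, glued at their endpoints (vertices) to form a connected space. Except in (2), the Dirichlet vertex set of $\widetilde{\mathcal G}$ is that of $\mathcal G$; pendant graphs are again compact, connected and finite. The torsion function $v$ of $\mathcal G$ with respect to $\mathsf V_{\mathrm D}$ is the unique function that is continuous on $\mathcal G$, in $H^2$ on each edge, with $-v_{\mathsf e}''=1$ on each edge, $v=0$ on $\mathsf V_{\mathrm D}$, and sum of normal derivatives over all incident edges equal to $0$ (Kirchhoff condition) at each vertex of $\mathsf V_{\mathrm N}$. The torsional rigidity is $T(\mathcal G)=T(\mathcal G;\mathsf V_{\mathrm D})=\int_{\mathcal G}v\,dx$; equivalently $T(\mathcal G;\mathsf V_{\mathrm D})=\max_{0\neq u\in H^1_0(\mathcal G;\mathsf V_{\mathrm D})}\left(\int_{\mathcal G}u\,dx\right)^2/\|u'\|_{L^2}^2$, where $H^1_0(\mathcal G;\mathsf V_{\mathrm D})$ is the space of continuous functions on $\mathcal G$ that are edgewise $H^1$ and vanish on $\mathsf V_{\mathrm D}$. *)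

theory Defs
  imports "HOL-Analysis.Analysis"
begin

section \<open>Finite metric graphs\<close>

text \<open>Multigraphs, loops and parallel edges allowed. An edge \<open>e\<close> is the interval
  \<open>[0, len G e]\<close>, with \<open>0\<close> glued to \<open>source G e\<close> and \<open>len G e\<close> glued to \<open>target G e\<close>;
  the orientation only serves to fix this parametrisation.\<close>

record ('v, 'e) metric_graph =
  verts :: "'v set"
  edges :: "'e set"
  source :: "'e \<Rightarrow> 'v"
  target :: "'e \<Rightarrow> 'v"
  len :: "'e \<Rightarrow> real"

definition edge_ends :: "('v, 'e) metric_graph \<Rightarrow> 'e \<Rightarrow> 'v set" where
  "edge_ends G e = {source G e, target G e}"

datatype ('v, 'e) point = Vertex 'v | Inner 'e real

definition points :: "('v, 'e) metric_graph \<Rightarrow> ('v, 'e) point set" where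
  "points G = Vertex ` verts G \<union> {Inner e x | e x. e \<in> edges G \<and> 0 < x \<and> x < len G e}"

definition edge_point :: "('v, 'e) metric_graph \<Rightarrow> 'e \<Rightarrow> real \<Rightarrow> ('v, 'e) point" where
  "edge_point G e x =
    (if x = 0 then Vertex (source G e)
     else if x = len G e then Vertex (target G e)
     else Inner e x)"

text \<open>The quotient topology: the finest topology on the points of \<open>G\<close> that makes all
  parametrisations \<open>edge_point G e\<close> continuous on \<open>[0, len G e]\<close>.\<close>

definition graph_topology :: "('v, 'e) metric_graph \<Rightarrow> ('v, 'e) point topology" where
  "graph_topology G = topology (\<lambda>U. U \<subseteq> points G \<and>
     (\<forall>e\<in>edges G. openin (top_of_set {0..len G e}) {x \<in> {0..len G e}. edge_point G e x \<in> U}))"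

lemma openin_graph_topology:
  "openin (graph_topology G) U \<longleftrightarrow> U \<subseteq> points G \<and>
     (\<forall>e\<in>edges G. openin (top_of_set {0..len G e}) {x \<in> {0..len G e}. edge_point G e x \<in> U})"
proof -
  let ?P = "\<lambda>U. U \<subseteq> points G \<and>
     (\<forall>e\<in>edges G. openin (top_of_set {0..len G e}) {x \<in> {0..len G e}. edge_point G e x \<in> U})"
  have "istopology ?P"
    unfolding istopology_def
  proof (intro conjI allI impI)
    fix S T assume S: "?P S" and T: "?P T"
    show "S \<inter> T \<subseteq> points G"
      using S by blast
    show "\<forall>e\<in>edges G. openin (top_of_set {0..len G e}) {x \<in> {0..len G e}. edge_point G e x \<in> S \<inter> T}"
    proof
      fix e assume e: "e \<in> edges G"
      have "{x \<in> {0..len G e}. edge_point G e x \<in> S \<inter> T} =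
          {x \<in> {0..len G e}. edge_point G e x \<in> S} \<inter> {x \<in> {0..len G e}. edge_point G e x \<in> T}"
        by blast
      then show "openin (top_of_set {0..len G e}) {x \<in> {0..len G e}. edge_point G e x \<in> S \<inter> T}"
        using S T e by (simp add: openin_Int)
    qed
  next
    fix K assume K: "\<forall>S\<in>K. ?P S"
    show "\<Union>K \<subseteq> points G"
      using K by blast
    show "\<forall>e\<in>edges G. openin (top_of_set {0..len G e}) {x \<in> {0..len G e}. edge_point G e x \<in> \<Union>K}"
    proof
      fix e assume e: "e \<in> edges G"
      have "{x \<in> {0..len G e}. edge_point G e x \<in> \<Union>K} =
          \<Union>((\<lambda>S. {x \<in> {0..len G e}. edge_point G e x \<in> S}) ` K)"
        by blast
      then show "openin (top_of_set {0..len G e}) {x \<in> {0..len G e}. edge_point G e x \<in> \<Union>K}"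
        using K e by (auto intro!: openin_Union)
    qed
  qed
  then show ?thesis
    by (simp add: graph_topology_def topology_inverse')
qed

text \<open>Compactness of the space is automatic, there being finitely many vertices and finitely
  many edges of finite length.\<close>

definition compact_connected_graph :: "('v, 'e) metric_graph \<Rightarrow> bool" where
  "compact_connected_graph G \<longleftrightarrow>
     finite (verts G) \<and> finite (edges G) \<and>
     (\<forall>e\<in>edges G. edge_ends G e \<subseteq> verts G \<and> 0 < len G e) \<and>
     connected_space (graph_topology G)"

section \<open>Torsion function and torsional rigidity\<close>

definition on_edge :: "('v, 'e) metric_graph \<Rightarrow> (('v, 'e) point \<Rightarrow> real) \<Rightarrow> 'e \<Rightarrow> real \<Rightarrow> real" where
  "on_edge G u e x = u (edge_point G e x)"

text \<open>\<open>f\<close> is the continuous representative of an element of \<open>H\<^sup>1(0, l)\<close>, with derivative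
  \<open>g\<close> in \<open>L\<^sup>2(0, l)\<close>. (On a bounded interval \<open>L\<^sup>2\<close> is contained in \<open>L\<^sup>1\<close>.)\<close>

definition H1_deriv :: "real \<Rightarrow> (real \<Rightarrow> real) \<Rightarrow> (real \<Rightarrow> real) \<Rightarrow> bool" where
  "H1_deriv l f g \<longleftrightarrow>
     g absolutely_integrable_on {0..l} \<and>
     (\<lambda>x. (g x)\<^sup>2) absolutely_integrable_on {0..l} \<and>
     (\<forall>x\<in>{0..l}. f x = f 0 + integral {0..x} g)"

definition H2_deriv2 :: "real \<Rightarrow> (real \<Rightarrow> real) \<Rightarrow> (real \<Rightarrow> real) \<Rightarrow> bool" where
  "H2_deriv2 l f h \<longleftrightarrow> (\<exists>g. H1_deriv l f g \<and> H1_deriv l g h)"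

text \<open>Sum of the derivatives pointing into the edges; a loop at \<open>v\<close> contributes at both
  of its ends.\<close>

definition normal_deriv_sum ::
  "('v, 'e) metric_graph \<Rightarrow> (('v, 'e) point \<Rightarrow> real) \<Rightarrow> 'v \<Rightarrow> real" where
  "normal_deriv_sum G u v =
     (\<Sum>e\<in>{e \<in> edges G. source G e = v}.
        vector_derivative (on_edge G u e) (at 0 within {0..len G e})) +
     (\<Sum>e\<in>{e \<in> edges G. target G e = v}.
        - vector_derivative (on_edge G u e) (at (len G e) within {0..len G e}))"

definition is_torsion_function ::
  "('v, 'e) metric_graph \<Rightarrow> 'v set \<Rightarrow> (('v, 'e) point \<Rightarrow> real) \<Rightarrow> bool" where
  "is_torsion_function G D u \<longleftrightarrow>
     continuous_map (graph_topology G) euclideanreal u \<and>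
     (\<forall>e\<in>edges G. \<exists>h. H2_deriv2 (len G e) (on_edge G u e) h \<and>
        (AE x in lebesgue_on {0..len G e}. - h x = 1)) \<and>
     (\<forall>v\<in>D. u (Vertex v) = 0) \<and>
     (\<forall>v\<in>verts G - D. normal_deriv_sum G u v = 0)"

text \<open>A function on \<open>G\<close> is unique only once its values at points outside \<open>G\<close> are fixed,
  hence \<open>extensional\<close>.\<close>

definition torsion_function ::
  "('v, 'e) metric_graph \<Rightarrow> 'v set \<Rightarrow> ('v, 'e) point \<Rightarrow> real" where
  "torsion_function G D = (THE u. u \<in> extensional (points G) \<and> is_torsion_function G D u)"

definition graph_integral :: "('v, 'e) metric_graph \<Rightarrow> (('v, 'e) point \<Rightarrow> real) \<Rightarrow> real" where
  "graph_integral G u = (\<Sum>e\<in>edges G. integral {0..len G e} (on_edge G u e))"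

definition torsional_rigidity :: "('v, 'e) metric_graph \<Rightarrow> 'v set \<Rightarrow> real" where
  "torsional_rigidity G D = graph_integral G (torsion_function G D)"

section \<open>Surgery operations\<close>

text \<open>The glued vertex keeps the name \<open>v\<close>; an edge between \<open>v\<close> and \<open>w\<close> becomes a loop.\<close>

definition glue_vertices :: "('v, 'e) metric_graph \<Rightarrow> 'v \<Rightarrow> 'v \<Rightarrow> ('v, 'e) metric_graph" where
  "glue_vertices G v w = G\<lparr>
     verts := verts G - {w},
     source := (\<lambda>e. if source G e = w then v else source G e),
     target := (\<lambda>e. if target G e = w then v else target G e)\<rparr>"

text \<open>\<open>H\<close> is a pendant of \<open>G\<close> at \<open>v\<close>: the vertex of \<open>H\<close> at which it is attached already
  carries the name \<open>v\<close>, and apart from it the two graphs are disjoint.\<close>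

definition pendant_at :: "('v, 'e) metric_graph \<Rightarrow> ('v, 'e) metric_graph \<Rightarrow> 'v \<Rightarrow> bool" where
  "pendant_at G H v \<longleftrightarrow> compact_connected_graph H \<and>
     verts G \<inter> verts H = {v} \<and> edges G \<inter> edges H = {}"

definition attach_graph ::
  "('v, 'e) metric_graph \<Rightarrow> ('v, 'e) metric_graph \<Rightarrow> ('v, 'e) metric_graph" where
  "attach_graph G H = \<lparr>
     verts = verts G \<union> verts H,
     edges = edges G \<union> edges H,
     source = (\<lambda>e. if e \<in> edges G then source G e else source H e),
     target = (\<lambda>e. if e \<in> edges G then target G e else target H e),
     len = (\<lambda>e. if e \<in> edges G then len G e else len H e)\<rparr>"

definition add_edge ::
  "('v, 'e) metric_graph \<Rightarrow> 'e \<Rightarrow> 'v \<Rightarrow> 'v \<Rightarrow> real \<Rightarrow> ('v, 'e) metric_graph" where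
  "add_edge G e a b l = G\<lparr>
     edges := insert e (edges G),
     source := (source G)(e := a),
     target := (target G)(e := b),
     len := (len G)(e := l)\<rparr>"

definition delete_edges :: "('v, 'e) metric_graph \<Rightarrow> 'e set \<Rightarrow> ('v, 'e) metric_graph" where
  "delete_edges G F = G\<lparr>edges := edges G - F\<rparr>"

definition set_edge_length :: "('v, 'e) metric_graph \<Rightarrow> 'e \<Rightarrow> real \<Rightarrow> ('v, 'e) metric_graph" where
  "set_edge_length G e l = G\<lparr>len := (len G)(e := l)\<rparr>"

definition scale_graph :: "real \<Rightarrow> ('v, 'e) metric_graph \<Rightarrow> ('v, 'e) metric_graph" where
  "scale_graph c G = G\<lparr>len := (\<lambda>e. c * len G e)\<rparr>"

end

theory Submission
  imports Defs
begin

text \<open>On each edge \<open>v'' = -1\<close> makes \<open>v\<close> a parabola determined by its two end values \<open>a\<close>, \<open>b\<close>, and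
  for such parabolas \<open>2 \<integral> v - \<integral> v'\<^sup>2\<close> equals \<open>(a + b) l + l\<^sup>3 / 12 - (b - a)\<^sup>2 / l\<close>. So the
  torsion function is encoded by its vertex values, the Kirchhoff conditions are the Euler-Lagrange
  equations of the sum of these edge terms, and the torsional rigidity is the maximum of this
  strictly concave function over the vertex functions that vanish on the Dirichlet set. Every
  surgery is then a comparison of two such finite-dimensional maxima by means of a test vector.\<close>

section \<open>Torsion on a single edge\<close>

text \<open>The maximum is the rigidity itself because testing the equation with its own solution
  makes the integral of v'^2 equal to that of v. By the weak equation, the energy lost by a
  competitor is exactly the Dirichlet form of its difference from the maximiser. Connectedness
  together with a Dirichlet vertex makes this form definite, so one identity yields the
  inequalities, the equality case of gluing and the strictness for an extra Dirichlet vertex.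
  Lengthening an edge and attaching new pieces also rely on the sign of the torsion function. The
  constant l^3/12 is the rigidity of an interval with both ends Dirichlet; it is strictly increasing
  and strictly superadditive in l, which makes lengthening and unfolding strict even where the
  vertex values vanish. Since \<open>torsion_function\<close> is a definite description, its
  existence and uniqueness are part of the proof.\<close>

definition edge_profile :: "real \<Rightarrow> real \<Rightarrow> real \<Rightarrow> real \<Rightarrow> real" where
  "edge_profile l a b x = a + ((b - a) / l + l / 2) * x - x\<^sup>2 / 2"

lemma edge_profile_0 [simp]: "edge_profile l a b 0 = a"
  by (simp add: edge_profile_def)

lemma edge_profile_len [simp]: "l \<noteq> 0 \<Longrightarrow> edge_profile l a b l = b"
  by (simp add: edge_profile_def field_simps power2_eq_square)

lemma continuous_on_edge_profile [continuous_intros]: "continuous_on S (edge_profile l a b)"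
  unfolding edge_profile_def by (intro continuous_intros) auto

lemma integral_edge_profile:
  assumes "0 < l"
  shows "integral {0..l} (edge_profile l a b) = (a + b) * l / 2 + l ^ 3 / 12"
proof -
  define c where "c = (b - a) / l + l / 2"
  have "((\<lambda>x. edge_profile l a b x) has_integral
      (a * l + c * l\<^sup>2 / 2 - l ^ 3 / 6) - (a * 0 + c * 0\<^sup>2 / 2 - 0 ^ 3 / 6)) {0..l}"
    using assms unfolding edge_profile_def c_def[symmetric]
    by (intro fundamental_theorem_of_calculus)
       (auto intro!: derivative_eq_intros simp: has_real_derivative_iff_has_vector_derivative [symmetric])
  then have "integral {0..l} (edge_profile l a b) = a * l + c * l\<^sup>2 / 2 - l ^ 3 / 6"
    by (simp add: integral_unique)
  also have "\<dots> = (a + b) * l / 2 + l ^ 3 / 12"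
    using assms by (simp add: c_def field_simps power2_eq_square power3_eq_cube)
  finally show ?thesis .
qed

lemma integral_minus_one_AE:
  assumes "AE x in lebesgue_on {0..l}. - h x = (1 :: real)" and "x \<in> {0..l}"
  shows "integral {0..x} h = - x"
proof -
  have "AE y in lebesgue. y \<in> {0..l} \<longrightarrow> - h y = 1"
    using assms(1) by (simp add: AE_restrict_space_iff)
  then obtain N where N: "{y. \<not> (y \<in> {0..l} \<longrightarrow> - h y = 1)} \<subseteq> N" "N \<in> null_sets lebesgue"
    unfolding eventually_ae_filter by auto
  have "integral {0..x} h = integral {0..x} (\<lambda>y. - 1)"
  proof (rule integral_spike)
    show "negligible N"
      using N(2) by (simp add: negligible_iff_null_sets)
    show "- 1 = h y" if "y \<in> {0..x} - N" for y
      using that N(1) assms(2) by force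
  qed
  then show ?thesis
    using assms(2) by simp
qed

lemma integral_affine:
  fixes c :: real
  assumes "0 \<le> x"
  shows "integral {0..x} (\<lambda>y. c - y) = c * x - x\<^sup>2 / 2"
proof -
  have "((\<lambda>y. c - y) has_integral (c * x - x\<^sup>2 / 2) - (c * 0 - 0\<^sup>2 / 2)) {0..x}"
    using assms
    by (intro fundamental_theorem_of_calculus)
       (auto intro!: derivative_eq_intros simp: has_real_derivative_iff_has_vector_derivative [symmetric])
  then show ?thesis
    by (simp add: integral_unique)
qed

text \<open>Integrating the almost everywhere equation twice makes the derivative affine with slope
  -1 and the function a parabola. The definition of H^2 is opened only here.\<close>

lemma H2_solution_iff_edge_profile:
  assumes l: "0 < l"
  shows "(\<exists>h. H2_deriv2 l f h \<and> (AE x in lebesgue_on {0..l}. - h x = 1)) \<longleftrightarrow>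
    (\<forall>x\<in>{0..l}. f x = edge_profile l (f 0) (f l) x)"
proof
  assume "\<exists>h. H2_deriv2 l f h \<and> (AE x in lebesgue_on {0..l}. - h x = 1)"
  then obtain g h where fg: "H1_deriv l f g" and gh: "H1_deriv l g h"
      and h: "AE x in lebesgue_on {0..l}. - h x = 1"
    unfolding H2_deriv2_def by blast
  have g: "g x = g 0 - x" if "x \<in> {0..l}" for x
  proof -
    have "g x = g 0 + integral {0..x} h"
      using gh that unfolding H1_deriv_def by blast
    then show ?thesis
      using integral_minus_one_AE[OF h that] by linarith
  qed
  have f: "f x = f 0 + g 0 * x - x\<^sup>2 / 2" if x: "x \<in> {0..l}" for x
  proof -
    have "f x = f 0 + integral {0..x} g"
      using fg x unfolding H1_deriv_def by blast
    also have "integral {0..x} g = integral {0..x} (\<lambda>y. g 0 - y)"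
      using x by (intro integral_cong g) auto
    also have "\<dots> = g 0 * x - x\<^sup>2 / 2"
      using x by (intro integral_affine) auto
    finally show ?thesis
      by (simp only: add_diff_eq)
  qed
  \<comment> \<open>Evaluation at the right end trades the unknown initial slope for the two end
    values.\<close>
  have "f l = f 0 + g 0 * l - l\<^sup>2 / 2"
    using l by (intro f) auto
  then have g0: "g 0 = (f l - f 0) / l + l / 2"
    using l by (simp add: field_simps power2_eq_square)
  show "\<forall>x\<in>{0..l}. f x = edge_profile l (f 0) (f l) x"
    using f unfolding edge_profile_def g0[symmetric] by blast
next
  assume f: "\<forall>x\<in>{0..l}. f x = edge_profile l (f 0) (f l) x"
  define c where "c = (f l - f 0) / l + l / 2"
  have abs_int: "k absolutely_integrable_on {0..l}" if "continuous_on {0..l} k" for k :: "real \<Rightarrow> real"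
    using that by (rule absolutely_integrable_continuous_real)
  have "H1_deriv l f (\<lambda>x. c - x)"
    unfolding H1_deriv_def
  proof (intro conjI ballI)
    fix x assume x: "x \<in> {0..l}"
    have "integral {0..x} (\<lambda>x. c - x) = c * x - x\<^sup>2 / 2"
      using x by (intro integral_affine) auto
    then show "f x = f 0 + integral {0..x} (\<lambda>x. c - x)"
      using f[rule_format, OF x] unfolding edge_profile_def c_def[symmetric] by linarith
  qed (auto intro!: abs_int continuous_intros)
  moreover have "H1_deriv l (\<lambda>x. c - x) (\<lambda>x. - 1)"
    unfolding H1_deriv_def by (auto intro!: abs_int continuous_intros)
  ultimately show "\<exists>h. H2_deriv2 l f h \<and> (AE x in lebesgue_on {0..l}. - h x = 1)"
    unfolding H2_deriv2_def by (intro exI[of _ "\<lambda>x. - 1"]) auto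
qed

lemma vector_derivative_edge_profile:
  assumes l: "0 < l" and f: "\<forall>x\<in>{0..l}. f x = edge_profile l a b x" and x: "x \<in> {0..l}"
  shows "vector_derivative f (at x within {0..l}) = (b - a) / l + l / 2 - x"
proof -
  have "(edge_profile l a b has_vector_derivative (b - a) / l + l / 2 - x) (at x within {0..l})"
    unfolding edge_profile_def
    by (auto intro!: derivative_eq_intros simp: has_real_derivative_iff_has_vector_derivative [symmetric])
  then have "(f has_vector_derivative (b - a) / l + l / 2 - x) (at x within {0..l})"
    using f x by (auto intro: has_vector_derivative_transform[where f = "edge_profile l a b"])
  then show ?thesis
    using vector_derivative_within_cbox[of 0 l x f] l x by (simp add: cbox_interval)
qed

section \<open>The discrete variational problem\<close>

definition edge_energy :: "real \<Rightarrow> real \<Rightarrow> real \<Rightarrow> real" where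
  "edge_energy l a b = (a + b) * l + l ^ 3 / 12 - (b - a)\<^sup>2 / l"

definition energy :: "('v, 'e) metric_graph \<Rightarrow> ('v \<Rightarrow> real) \<Rightarrow> real" where
  "energy G \<phi> = (\<Sum>e\<in>edges G. edge_energy (len G e) (\<phi> (source G e)) (\<phi> (target G e)))"

text \<open>The form of the weighted graph Laplacian with conductances \<open>1 / len G e\<close>,
  or the L^2 product of the derivatives of the edgewise affine interpolants.\<close>

definition dirichlet_form :: "('v, 'e) metric_graph \<Rightarrow> ('v \<Rightarrow> real) \<Rightarrow> ('v \<Rightarrow> real) \<Rightarrow> real" where
  "dirichlet_form G \<phi> \<psi> = (\<Sum>e\<in>edges G.
     (\<phi> (target G e) - \<phi> (source G e)) * (\<psi> (target G e) - \<psi> (source G e)) / len G e)"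

text \<open>The integral of the edgewise affine interpolant of \<open>\<psi>\<close>.\<close>

definition load :: "('v, 'e) metric_graph \<Rightarrow> ('v \<Rightarrow> real) \<Rightarrow> real" where
  "load G \<psi> = (\<Sum>e\<in>edges G. len G e * (\<psi> (source G e) + \<psi> (target G e)) / 2)"

definition unit_at :: "'v \<Rightarrow> 'v \<Rightarrow> real" where
  "unit_at v w = (if w = v then 1 else 0)"

definition vanishes_on :: "'v set \<Rightarrow> ('v \<Rightarrow> real) \<Rightarrow> bool" where
  "vanishes_on D \<phi> \<longleftrightarrow> (\<forall>v\<in>D. \<phi> v = 0)"

text \<open>Connectedness is stated combinatorially: a nonempty vertex set that no edge leaves is
  everything. In this form it passes through each surgery without returning to the quotient
  topology.\<close>

locale connected_graph =
  fixes G :: "('v, 'e) metric_graph"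
  assumes finite_verts: "finite (verts G)"
    and finite_edges: "finite (edges G)"
    and source_in: "e \<in> edges G \<Longrightarrow> source G e \<in> verts G"
    and target_in: "e \<in> edges G \<Longrightarrow> target G e \<in> verts G"
    and len_pos: "e \<in> edges G \<Longrightarrow> 0 < len G e"
    and no_separation:
      "\<lbrakk>S \<subseteq> verts G; S \<noteq> {}; \<And>e. e \<in> edges G \<Longrightarrow> source G e \<in> S \<longleftrightarrow> target G e \<in> S\<rbrakk>
        \<Longrightarrow> S = verts G"
begin

section \<open>Algebra of the Dirichlet form and the load\<close>

lemma energy_eq:
  "energy G \<phi> = 2 * load G \<phi> + (\<Sum>e\<in>edges G. len G e ^ 3 / 12) - dirichlet_form G \<phi> \<phi>"
  unfolding energy_def load_def dirichlet_form_def edge_energy_def sum_distrib_left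
    sum.distrib[symmetric] sum_subtractf[symmetric]
  by (intro sum.cong) (auto simp: power2_eq_square algebra_simps)

lemma dirichlet_form_add_left:
  "dirichlet_form G (\<lambda>v. \<phi> v + \<eta> v) \<psi> = dirichlet_form G \<phi> \<psi> + dirichlet_form G \<eta> \<psi>"
  unfolding dirichlet_form_def sum.distrib[symmetric]
  by (intro sum.cong) (auto simp: diff_divide_distrib add_divide_distrib algebra_simps)

lemma dirichlet_form_scale_left:
  "dirichlet_form G (\<lambda>v. c * \<phi> v) \<psi> = c * dirichlet_form G \<phi> \<psi>"
  unfolding dirichlet_form_def sum_distrib_left
  by (intro sum.cong) (auto simp: diff_divide_distrib add_divide_distrib algebra_simps)

lemma dirichlet_form_diff:
  "dirichlet_form G (\<lambda>v. \<phi> v - \<psi> v) (\<lambda>v. \<phi> v - \<psi> v) =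
    dirichlet_form G \<phi> \<phi> - 2 * dirichlet_form G \<psi> \<phi> + dirichlet_form G \<psi> \<psi>"
  unfolding dirichlet_form_def sum_distrib_left sum.distrib[symmetric] sum_subtractf[symmetric]
  by (intro sum.cong) (auto simp: diff_divide_distrib add_divide_distrib algebra_simps)

lemma dirichlet_form_nonneg: "0 \<le> dirichlet_form G \<phi> \<phi>"
  unfolding dirichlet_form_def by (intro sum_nonneg) (auto simp: less_imp_le[OF len_pos])

text \<open>All summands vanish, so no edge carries a jump; no edge then leaves the level set of
  \<open>\<phi>\<close> through \<open>w\<close>, which is therefore all of
  \<open>verts G\<close>.\<close>

lemma dirichlet_form_eq_0_imp_constant:
  assumes "dirichlet_form G \<phi> \<phi> = 0" and v: "v \<in> verts G" and w: "w \<in> verts G"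
  shows "\<phi> v = \<phi> w"
proof -
  have "\<forall>e\<in>edges G. (\<phi> (target G e) - \<phi> (source G e)) * (\<phi> (target G e) - \<phi> (source G e)) / len G e = 0"
    using assms(1) unfolding dirichlet_form_def
    by (subst (asm) sum_nonneg_eq_0_iff) (auto simp: finite_edges less_imp_le[OF len_pos])
  then have "\<phi> (target G e) = \<phi> (source G e)" if "e \<in> edges G" for e
    using that len_pos[OF that] by auto
  then have "{x \<in> verts G. \<phi> x = \<phi> w} = verts G"
    using w by (intro no_separation) (auto simp: source_in target_in)
  then show ?thesis
    using v by blast
qed

lemma sum_unit_at: "v \<in> verts G \<Longrightarrow> (\<Sum>x\<in>verts G. \<psi> x * unit_at x v) = \<psi> v"
  by (simp add: unit_at_def finite_verts if_distrib[of "\<lambda>z. _ * z"] cong: if_cong)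

text \<open>Discrete integration by parts: expanding \<open>\<psi>\<close> in vertex indicators lets
  one equation per vertex be combined into an equation for every test function.\<close>

lemma dirichlet_form_expand:
  "dirichlet_form G \<phi> \<psi> = (\<Sum>v\<in>verts G. \<psi> v * dirichlet_form G \<phi> (unit_at v))"
proof -
  have "(\<Sum>v\<in>verts G. \<psi> v * dirichlet_form G \<phi> (unit_at v)) =
    (\<Sum>e\<in>edges G. \<Sum>v\<in>verts G. \<psi> v * ((\<phi> (target G e) - \<phi> (source G e)) *
       (unit_at v (target G e) - unit_at v (source G e)) / len G e))"
    unfolding dirichlet_form_def sum_distrib_left by (rule sum.swap)
  also have "\<dots> = dirichlet_form G \<phi> \<psi>"
    unfolding dirichlet_form_def
  proof (rule sum.cong[OF refl])
    fix e assume e: "e \<in> edges G"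
    have "(\<Sum>v\<in>verts G. \<psi> v * ((\<phi> (target G e) - \<phi> (source G e)) *
       (unit_at v (target G e) - unit_at v (source G e)) / len G e)) =
      (\<phi> (target G e) - \<phi> (source G e)) / len G e *
       ((\<Sum>v\<in>verts G. \<psi> v * unit_at v (target G e)) - (\<Sum>v\<in>verts G. \<psi> v * unit_at v (source G e)))"
      unfolding sum_subtractf[symmetric] sum_distrib_left
      by (intro sum.cong) (auto simp: diff_divide_distrib add_divide_distrib algebra_simps)
    then show "(\<Sum>v\<in>verts G. \<psi> v * ((\<phi> (target G e) - \<phi> (source G e)) *
       (unit_at v (target G e) - unit_at v (source G e)) / len G e)) =
      (\<phi> (target G e) - \<phi> (source G e)) * (\<psi> (target G e) - \<psi> (source G e)) / len G e"
      using e by (simp add: sum_unit_at source_in target_in)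
  qed
  finally show ?thesis ..
qed

lemma load_expand: "load G \<psi> = (\<Sum>v\<in>verts G. \<psi> v * load G (unit_at v))"
proof -
  have "(\<Sum>v\<in>verts G. \<psi> v * load G (unit_at v)) =
    (\<Sum>e\<in>edges G. \<Sum>v\<in>verts G. \<psi> v * (len G e * (unit_at v (source G e) + unit_at v (target G e)) / 2))"
    unfolding load_def sum_distrib_left by (rule sum.swap)
  also have "\<dots> = load G \<psi>"
    unfolding load_def
  proof (rule sum.cong[OF refl])
    fix e assume e: "e \<in> edges G"
    have "(\<Sum>v\<in>verts G. \<psi> v * (len G e * (unit_at v (source G e) + unit_at v (target G e)) / 2)) =
      len G e / 2 *
       ((\<Sum>v\<in>verts G. \<psi> v * unit_at v (source G e)) + (\<Sum>v\<in>verts G. \<psi> v * unit_at v (target G e)))"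
      unfolding sum.distrib[symmetric] sum_distrib_left
      by (intro sum.cong) (auto simp: algebra_simps)
    then show "(\<Sum>v\<in>verts G. \<psi> v * (len G e * (unit_at v (source G e) + unit_at v (target G e)) / 2)) =
      len G e * (\<psi> (source G e) + \<psi> (target G e)) / 2"
      using e by (simp add: sum_unit_at source_in target_in)
  qed
  finally show ?thesis ..
qed

end

section \<open>The discrete Poisson problem: existence, uniqueness, positivity\<close>

locale dirichlet_graph = connected_graph G for G :: "('v, 'e) metric_graph" +
  fixes D :: "'v set"
  assumes D_subset: "D \<subseteq> verts G"
    and D_nonempty: "D \<noteq> {}"
begin

text \<open>Values outside \<open>verts G\<close> are left free, so uniqueness can be claimed on
  \<open>verts G\<close> only.\<close>

definition discrete_torsion :: "('v \<Rightarrow> real) \<Rightarrow> bool" where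
  "discrete_torsion \<phi> \<longleftrightarrow> vanishes_on D \<phi> \<and>
     (\<forall>v\<in>verts G - D. dirichlet_form G \<phi> (unit_at v) = load G (unit_at v))"

text \<open>Zero form means constant, and a vertex of \<open>D\<close> pins the constant to
  zero.\<close>

lemma definite:
  assumes "vanishes_on D \<phi>" "dirichlet_form G \<phi> \<phi> = 0" "v \<in> verts G"
  shows "\<phi> v = 0"
  using dirichlet_form_eq_0_imp_constant[OF assms(2,3)] assms(1) D_nonempty D_subset
  unfolding vanishes_on_def by fastforce

text \<open>Gaussian elimination, one vertex at a time; definiteness keeps the pivots nonzero.\<close>

lemma partial_solution:
  assumes "finite K" "K \<subseteq> verts G - D"
  shows "\<exists>\<phi>. (\<forall>v. v \<notin> K \<longrightarrow> \<phi> v = 0) \<and> (\<forall>v\<in>K. dirichlet_form G \<phi> (unit_at v) = r v)"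
  using assms
proof (induction K arbitrary: r rule: finite_induct)
  case empty
  show ?case by (rule exI[of _ "\<lambda>_. 0"]) simp
next
  case (insert x K)
  from insert.IH[of r] insert.prems obtain \<phi> where \<phi>0: "\<And>v. v \<notin> K \<Longrightarrow> \<phi> v = 0"
      and \<phi>: "\<And>v. v \<in> K \<Longrightarrow> dirichlet_form G \<phi> (unit_at v) = r v"
    by blast
  \<comment> \<open>Second use of the hypothesis, with the negated coupling of \<open>x\<close> to
    \<open>K\<close> on the right: adding \<open>\<psi>\<close> to the unit vector at
    \<open>x\<close> gives \<open>\<eta>\<close>, orthogonal in the form to every vertex of
    \<open>K\<close>.\<close>
  from insert.IH[of "\<lambda>v. - dirichlet_form G (unit_at x) (unit_at v)"] insert.prems
  obtain \<psi> where \<psi>0: "\<And>v. v \<notin> K \<Longrightarrow> \<psi> v = 0"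
      and \<psi>: "\<And>v. v \<in> K \<Longrightarrow> dirichlet_form G \<psi> (unit_at v) = - dirichlet_form G (unit_at x) (unit_at v)"
    by blast
  define \<eta> where "\<eta> = (\<lambda>v. unit_at x v + \<psi> v)"
  have \<eta>K: "dirichlet_form G \<eta> (unit_at v) = 0" if "v \<in> K" for v
    using \<psi>[OF that] by (simp add: \<eta>_def dirichlet_form_add_left)
  have \<eta>0: "\<eta> v = 0" if "v \<notin> insert x K" for v
    using that \<psi>0[of v] by (simp add: \<eta>_def unit_at_def)
  have \<eta>x: "\<eta> x = 1"
    using \<psi>0[of x] insert.hyps by (simp add: \<eta>_def unit_at_def)
  \<comment> \<open>Since \<open>\<eta>\<close> is 1 at \<open>x\<close> and orthogonal to
    \<open>K\<close>, this pivot is the form of \<open>\<eta>\<close> with itself.\<close>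
  define p where "p = dirichlet_form G \<eta> (unit_at x)"
  have "p \<noteq> 0"
  proof
    assume "p = 0"
    then have "\<eta> v * dirichlet_form G \<eta> (unit_at v) = 0" for v
      using \<eta>K[of v] \<eta>0[of v] by (cases "v \<in> insert x K") (auto simp: p_def)
    then have "dirichlet_form G \<eta> \<eta> = 0"
      by (subst dirichlet_form_expand) (intro sum.neutral ballI)
    moreover have "vanishes_on D \<eta>"
      using \<eta>0 insert.prems unfolding vanishes_on_def by blast
    ultimately show False
      using definite[of \<eta> x] insert.prems \<eta>x by auto
  qed
  \<comment> \<open>Adding a multiple of \<open>\<eta>\<close> leaves the equations on
    \<open>K\<close> intact, so \<open>t\<close> is free to solve the one at
    \<open>x\<close>.\<close>
  define t where "t = (r x - dirichlet_form G \<phi> (unit_at x)) / p"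
  have t: "dirichlet_form G \<phi> (unit_at x) + t * dirichlet_form G \<eta> (unit_at x) = r x"
    using \<open>p \<noteq> 0\<close> by (simp add: t_def flip: p_def)
  let ?s = "\<lambda>v. \<phi> v + t * \<eta> v"
  have "?s v = 0" if "v \<notin> insert x K" for v
    using that \<phi>0 \<eta>0 by auto
  moreover have "dirichlet_form G ?s (unit_at v) = r v" if "v \<in> insert x K" for v
  proof (cases "v = x")
    case True
    then show ?thesis
      using t by (simp add: dirichlet_form_add_left dirichlet_form_scale_left)
  next
    case False
    then show ?thesis
      using that \<phi> \<eta>K by (auto simp: dirichlet_form_add_left dirichlet_form_scale_left)
  qed
  ultimately show ?case
    by (intro exI[of _ ?s] conjI allI impI ballI)
qed

lemma discrete_torsion_exists: "\<exists>\<phi>. discrete_torsion \<phi>"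
proof -
  obtain \<phi> where "\<And>v. v \<notin> verts G - D \<Longrightarrow> \<phi> v = 0"
      and "\<And>v. v \<in> verts G - D \<Longrightarrow> dirichlet_form G \<phi> (unit_at v) = load G (unit_at v)"
    using partial_solution[of "verts G - D" "\<lambda>v. load G (unit_at v)"] finite_verts by auto
  then show ?thesis
    unfolding discrete_torsion_def vanishes_on_def by blast
qed

text \<open>Multiply the equation at each free vertex by \<open>\<psi> v\<close> and sum; vertices
  of \<open>D\<close> drop out because \<open>\<psi>\<close> vanishes there.\<close>

lemma discrete_torsion_weak:
  assumes "discrete_torsion \<phi>" "vanishes_on D \<psi>"
  shows "dirichlet_form G \<phi> \<psi> = load G \<psi>"
  using assms unfolding discrete_torsion_def vanishes_on_def
  by (subst dirichlet_form_expand, subst load_expand) (auto intro!: sum.cong)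

text \<open>The weak equation with \<open>\<phi>\<close> as its own test function cancels one of the
  two loads in the energy; what remains is the integral of the corresponding parabolas.\<close>

lemma energy_discrete_torsion:
  assumes "discrete_torsion \<phi>"
  shows "energy G \<phi> = load G \<phi> + (\<Sum>e\<in>edges G. len G e ^ 3 / 12)"
  using discrete_torsion_weak[OF assms, of \<phi>] assms
  by (simp add: energy_eq discrete_torsion_def)

text \<open>Completing the square: the weak equation, tested with both \<open>\<phi>\<close> and
  \<open>\<eta>\<close>, replaces each load by a value of the form.\<close>

lemma energy_deficit:
  assumes "discrete_torsion \<phi>" "vanishes_on D \<eta>"
  shows "energy G \<phi> - energy G \<eta> = dirichlet_form G (\<lambda>v. \<eta> v - \<phi> v) (\<lambda>v. \<eta> v - \<phi> v)"
  using discrete_torsion_weak[OF assms(1), of \<phi>] discrete_torsion_weak[OF assms] assms(1)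
  by (simp add: energy_eq dirichlet_form_diff discrete_torsion_def)

lemma energy_le:
  assumes "discrete_torsion \<phi>" "vanishes_on D \<eta>"
  shows "energy G \<eta> \<le> energy G \<phi>"
  using energy_deficit[OF assms] dirichlet_form_nonneg[of "\<lambda>v. \<eta> v - \<phi> v"] by linarith

text \<open>A competitor that does as well has zero deficit, and definiteness then forces agreement.
  This is the source of the equality case for gluing and of strictness for an added Dirichlet
  vertex.\<close>

lemma energy_maximiser_unique:
  assumes "discrete_torsion \<phi>" "vanishes_on D \<eta>" "energy G \<phi> \<le> energy G \<eta>" "v \<in> verts G"
  shows "\<eta> v = \<phi> v"
proof -
  have "dirichlet_form G (\<lambda>v. \<eta> v - \<phi> v) (\<lambda>v. \<eta> v - \<phi> v) = 0"
    using energy_deficit[OF assms(1,2)] assms(3) dirichlet_form_nonneg[of "\<lambda>v. \<eta> v - \<phi> v"]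
    by linarith
  moreover have "vanishes_on D (\<lambda>v. \<eta> v - \<phi> v)"
    using assms(1,2) by (simp add: vanishes_on_def discrete_torsion_def)
  ultimately show ?thesis
    using definite assms(4) by fastforce
qed

lemma discrete_torsion_unique:
  assumes "discrete_torsion \<phi>" "discrete_torsion \<eta>" "v \<in> verts G"
  shows "\<eta> v = \<phi> v"
  using assms energy_le[OF assms(2), of \<phi>]
  by (intro energy_maximiser_unique) (auto simp: discrete_torsion_def)

text \<open>Passing from \<open>\<phi>\<close> to \<open>\<bar>\<phi>\<bar>\<close> does not decrease the energy.\<close>

lemma discrete_torsion_nonneg:
  assumes "discrete_torsion \<phi>" "v \<in> verts G"
  shows "0 \<le> \<phi> v"
proof -
  let ?\<psi> = "\<lambda>v. \<bar>\<phi> v\<bar>"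
  have "edge_energy l a b \<le> edge_energy l \<bar>a\<bar> \<bar>b\<bar>" if "0 < l" for l a b
  proof -
    have "(\<bar>b\<bar> - \<bar>a\<bar>)\<^sup>2 \<le> (b - a)\<^sup>2"
      by (metis abs_le_square_iff abs_triangle_ineq3)
    then have "(\<bar>b\<bar> - \<bar>a\<bar>)\<^sup>2 / l \<le> (b - a)\<^sup>2 / l"
      using that by (simp add: divide_right_mono)
    moreover have "(a + b) * l \<le> (\<bar>a\<bar> + \<bar>b\<bar>) * l"
      using that by (intro mult_right_mono) auto
    ultimately show ?thesis
      by (simp add: edge_energy_def)
  qed
  then have "energy G \<phi> \<le> energy G ?\<psi>"
    unfolding energy_def by (intro sum_mono) (auto simp: len_pos)
  \<comment> \<open>Uniqueness of the maximiser turns the comparison into agreement of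
    \<open>\<phi>\<close> with its absolute value.\<close>
  then have "?\<psi> v = \<phi> v"
    using assms by (intro energy_maximiser_unique) (auto simp: discrete_torsion_def vanishes_on_def)
  then show ?thesis by linarith
qed

text \<open>Strong minimum principle: at a free vertex with value zero all neighbours are at least
  as high, so the form against its indicator is nonpositive, whereas the load there is
  positive.\<close>

lemma discrete_torsion_pos:
  assumes \<phi>: "discrete_torsion \<phi>" and v: "v \<in> verts G - D"
  shows "0 < \<phi> v"
proof (rule ccontr)
  assume "\<not> 0 < \<phi> v"
  with discrete_torsion_nonneg[OF \<phi>, of v] v have \<phi>v: "\<phi> v = 0" by force
  have "dirichlet_form G \<phi> (unit_at v) \<le> 0"
    unfolding dirichlet_form_def
  proof (rule sum_nonpos)
    fix e assume e: "e \<in> edges G"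
    have "0 \<le> \<phi> (source G e)" "0 \<le> \<phi> (target G e)"
      using discrete_torsion_nonneg[OF \<phi>] e source_in target_in by auto
    then show "(\<phi> (target G e) - \<phi> (source G e)) *
        (unit_at v (target G e) - unit_at v (source G e)) / len G e \<le> 0"
      using \<phi>v len_pos[OF e] by (auto simp: unit_at_def divide_nonpos_pos)
  qed
  moreover have "0 < load G (unit_at v)"
  proof -
    \<comment> \<open>An isolated \<open>v\<close> would be the only vertex, leaving no room for a
      Dirichlet vertex.\<close>
    have "\<exists>e\<in>edges G. source G e = v \<or> target G e = v"
    proof (rule ccontr)
      assume "\<not> ?thesis"
      then have "{v} = verts G"
        using v by (intro no_separation) auto
      then show False
        using v D_nonempty D_subset by auto
    qed
    then obtain e where e: "e \<in> edges G" "source G e = v \<or> target G e = v" by blast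
    show ?thesis
      unfolding load_def
    proof (rule sum_pos2)
      show "finite (edges G)" "e \<in> edges G"
        using e finite_edges by auto
      show "0 < len G e * (unit_at v (source G e) + unit_at v (target G e)) / 2"
        using e len_pos[OF e(1)] by (auto simp: unit_at_def)
      show "0 \<le> len G i * (unit_at v (source G i) + unit_at v (target G i)) / 2"
        if "i \<in> edges G" for i
        using len_pos[OF that] by (auto simp: unit_at_def)
    qed
  qed
  ultimately show False
    using \<phi> v by (auto simp: discrete_torsion_def)
qed


end

section \<open>From the torsion function to its vertex values\<close>

lemma (in connected_graph) edge_point_in_points:
  "\<lbrakk>e \<in> edges G; x \<in> {0..len G e}\<rbrakk> \<Longrightarrow> edge_point G e x \<in> points G"
  using source_in target_in by (auto simp: edge_point_def points_def)

lemma (in connected_graph) topspace_graph_topology: "topspace (graph_topology G) = points G"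
proof (rule antisym)
  show "topspace (graph_topology G) \<subseteq> points G"
    using openin_topspace[of "graph_topology G"] unfolding openin_graph_topology by blast
  have "{x \<in> {0..len G e}. edge_point G e x \<in> points G} = {0..len G e}" if "e \<in> edges G" for e
    using edge_point_in_points[OF that] by auto
  then have "openin (graph_topology G) (points G)"
    unfolding openin_graph_topology by simp
  then show "points G \<subseteq> topspace (graph_topology G)"
    by (rule openin_subset)
qed

text \<open>The universal property of the quotient topology, for real-valued functions.\<close>

lemma (in connected_graph) continuous_map_graphI:
  fixes u :: "('v, 'e) point \<Rightarrow> real"
  assumes "\<And>e. e \<in> edges G \<Longrightarrow> continuous_on {0..len G e} (on_edge G u e)"
  shows "continuous_map (graph_topology G) euclideanreal u"
  unfolding continuous_map_def
proof (intro conjI allI impI)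
  fix U :: "real set" assume "openin euclideanreal U"
  then have U: "open U" by simp
  show "openin (graph_topology G) {x \<in> topspace (graph_topology G). u x \<in> U}"
    unfolding openin_graph_topology topspace_graph_topology
  proof (intro conjI ballI)
    fix e assume e: "e \<in> edges G"
    have "{x \<in> {0..len G e}. edge_point G e x \<in> {x \<in> points G. u x \<in> U}} =
        {0..len G e} \<inter> on_edge G u e -` U"
      using edge_point_in_points[OF e] by (auto simp: on_edge_def)
    then show "openin (top_of_set {0..len G e})
        {x \<in> {0..len G e}. edge_point G e x \<in> {x \<in> points G. u x \<in> U}}"
      using continuous_openin_preimage_gen[OF assms[OF e] U] by simp
  qed auto
qed auto

text \<open>A proper nonempty vertex set that no edge leaves, enlarged by the interiors of its
  edges, and the same enlargement of its complement would split the space into two open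
  pieces.\<close>

lemma compact_connected_graph_imp_connected_graph:
  assumes G: "compact_connected_graph G"
  shows "connected_graph G"
proof
  show "finite (verts G)" "finite (edges G)"
    using G by (auto simp: compact_connected_graph_def)
  show ends: "source G e \<in> verts G" "target G e \<in> verts G" and len: "0 < len G e"
    if "e \<in> edges G" for e
    using G that by (auto simp: compact_connected_graph_def edge_ends_def)
  show "S = verts G"
    if S: "S \<subseteq> verts G" "S \<noteq> {}"
      and closed: "\<And>e. e \<in> edges G \<Longrightarrow> source G e \<in> S \<longleftrightarrow> target G e \<in> S" for S
  proof (rule ccontr)
    assume "S \<noteq> verts G"
    \<comment> \<open>Interiors are assigned by their source. When no edge leaves \<open>A\<close>,
      each edge lies wholly inside or wholly outside the star, so its preimage there is everything
      or empty.\<close>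
    define star where "star A = Vertex ` A \<union>
      {Inner e x | e x. e \<in> edges G \<and> 0 < x \<and> x < len G e \<and> source G e \<in> A}" for A
    have star_open: "openin (graph_topology G) (star A)"
      if A: "A \<subseteq> verts G" and closedA: "\<And>e. e \<in> edges G \<Longrightarrow> source G e \<in> A \<longleftrightarrow> target G e \<in> A" for A
      unfolding openin_graph_topology
    proof (intro conjI ballI)
      show "star A \<subseteq> points G"
        using A by (auto simp: star_def points_def)
      fix e assume e: "e \<in> edges G"
      have "{x \<in> {0..len G e}. edge_point G e x \<in> star A} = (if source G e \<in> A then {0..len G e} else {})"
        using closedA[OF e] e by (auto simp: star_def edge_point_def)
      then show "openin (top_of_set {0..len G e}) {x \<in> {0..len G e}. edge_point G e x \<in> star A}"
        by simp
    qed
    have "topspace (graph_topology G) \<subseteq> points G"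
      using openin_topspace[of "graph_topology G"] unfolding openin_graph_topology by blast
    also have "points G \<subseteq> star S \<union> star (verts G - S)"
      using ends by (auto simp: points_def star_def)
    finally have "topspace (graph_topology G) \<subseteq> star S \<union> star (verts G - S)" .
    moreover have "star S \<inter> star (verts G - S) = {}"
      by (auto simp: star_def)
    moreover have "star S \<noteq> {}" "star (verts G - S) \<noteq> {}"
      using S \<open>S \<noteq> verts G\<close> by (auto simp: star_def)
    moreover have "openin (graph_topology G) (star S)"
      using S closed by (intro star_open) auto
    moreover have "openin (graph_topology G) (star (verts G - S))"
      using closed ends by (intro star_open) auto
    ultimately show False
      using G unfolding compact_connected_graph_def connected_space_def by blast
  qed
qed

section \<open>Edgewise parabolic functions and their Kirchhoff sums\<close>

definition vertex_torsion :: "('v, 'e) metric_graph \<Rightarrow> 'v set \<Rightarrow> 'v \<Rightarrow> real" where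
  "vertex_torsion G D v = torsion_function G D (Vertex v)"

definition edgewise_parabolic :: "('v, 'e) metric_graph \<Rightarrow> (('v, 'e) point \<Rightarrow> real) \<Rightarrow> bool" where
  "edgewise_parabolic G u \<longleftrightarrow> (\<forall>e\<in>edges G. \<forall>x\<in>{0..len G e}.
     on_edge G u e x = edge_profile (len G e) (u (Vertex (source G e))) (u (Vertex (target G e))) x)"

text \<open>Restricted to \<open>points G\<close> so that it is extensional, as the description in
  \<open>torsion_function\<close> demands.\<close>

definition interpolate :: "('v, 'e) metric_graph \<Rightarrow> ('v \<Rightarrow> real) \<Rightarrow> ('v, 'e) point \<Rightarrow> real" where
  "interpolate G \<phi> = restrict (\<lambda>p. case p of Vertex v \<Rightarrow> \<phi> v
     | Inner e x \<Rightarrow> edge_profile (len G e) (\<phi> (source G e)) (\<phi> (target G e)) x) (points G)"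

lemma interpolate_Vertex: "v \<in> verts G \<Longrightarrow> interpolate G \<phi> (Vertex v) = \<phi> v"
  by (simp add: interpolate_def points_def)

context connected_graph
begin

lemma on_edge_source: "on_edge G u e 0 = u (Vertex (source G e))"
  by (simp add: on_edge_def edge_point_def)

lemma on_edge_target: "e \<in> edges G \<Longrightarrow> on_edge G u e (len G e) = u (Vertex (target G e))"
  using len_pos[of e] by (simp add: on_edge_def edge_point_def)

lemma edgewise_parabolic_interpolate: "edgewise_parabolic G (interpolate G \<phi>)"
  unfolding edgewise_parabolic_def
proof (intro ballI)
  fix e x assume e: "e \<in> edges G" and x: "x \<in> {0..len G e}"
  have ends: "interpolate G \<phi> (Vertex (source G e)) = \<phi> (source G e)"
      "interpolate G \<phi> (Vertex (target G e)) = \<phi> (target G e)"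
    using e by (simp_all add: interpolate_Vertex source_in target_in)
  have "interpolate G \<phi> (Inner e x) = edge_profile (len G e) (\<phi> (source G e)) (\<phi> (target G e)) x"
    if "x \<noteq> 0" "x \<noteq> len G e"
    using that e x by (auto simp: interpolate_def points_def)
  then show "on_edge G (interpolate G \<phi>) e x = edge_profile (len G e)
      (interpolate G \<phi> (Vertex (source G e))) (interpolate G \<phi> (Vertex (target G e))) x"
    unfolding ends using ends len_pos[OF e] by (auto simp: on_edge_def edge_point_def)
qed

lemma edgewise_parabolic_iff:
  "edgewise_parabolic G u \<longleftrightarrow>
    (\<forall>e\<in>edges G. \<exists>h. H2_deriv2 (len G e) (on_edge G u e) h \<and>
        (AE x in lebesgue_on {0..len G e}. - h x = 1))"
  unfolding edgewise_parabolic_def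
  by (simp only: H2_solution_iff_edge_profile len_pos on_edge_source on_edge_target cong: ball_cong)

text \<open>\<open>u\<close> lives on the glued points, so its branches at a vertex share their
  value there and continuity can be checked edge by edge.\<close>

lemma edgewise_parabolic_imp_continuous:
  assumes "edgewise_parabolic G u"
  shows "continuous_map (graph_topology G) euclideanreal u"
proof (rule continuous_map_graphI)
  fix e assume "e \<in> edges G"
  then show "continuous_on {0..len G e} (on_edge G u e)"
    using assms continuous_on_edge_profile unfolding edgewise_parabolic_def
    by (metis (no_types, lifting) continuous_on_cong)
qed

text \<open>Kirchhoff sums are the residual of the discrete equation: each end of an edge
  contributes half the length to the load and a signed difference quotient to the form. For a loop
  the quotients vanish and its whole length enters the load.\<close>

lemma normal_deriv_sum_eq:
  assumes u: "edgewise_parabolic G u"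
  shows "normal_deriv_sum G u v =
    load G (unit_at v) - dirichlet_form G (\<lambda>v. u (Vertex v)) (unit_at v)"
proof -
  let ?d = "\<lambda>e. (u (Vertex (target G e)) - u (Vertex (source G e))) / len G e"
  have deriv: "vector_derivative (on_edge G u e) (at x within {0..len G e}) = ?d e + len G e / 2 - x"
    if "e \<in> edges G" "x \<in> {0..len G e}" for e x
    using that u len_pos unfolding edgewise_parabolic_def
    by (intro vector_derivative_edge_profile) auto
  have "normal_deriv_sum G u v =
    (\<Sum>e\<in>edges G. if source G e = v then ?d e + len G e / 2 else 0) +
    (\<Sum>e\<in>edges G. if target G e = v then len G e / 2 - ?d e else 0)"
    unfolding normal_deriv_sum_def sum.inter_filter[OF finite_edges, symmetric]
    using len_pos
    by (intro arg_cong2[where f = "(+)"] sum.cong) (auto simp: deriv less_imp_le)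
  also have "\<dots> = load G (unit_at v) - dirichlet_form G (\<lambda>v. u (Vertex v)) (unit_at v)"
    unfolding load_def dirichlet_form_def sum.distrib[symmetric] sum_subtractf[symmetric]
    by (intro sum.cong) (auto simp: unit_at_def)
  finally show ?thesis .
qed

lemma edgewise_parabolic_ext:
  assumes "edgewise_parabolic G u" "edgewise_parabolic G w"
    and "u \<in> extensional (points G)" "w \<in> extensional (points G)"
    and verts: "\<And>v. v \<in> verts G \<Longrightarrow> u (Vertex v) = w (Vertex v)"
  shows "u = w"
proof (rule extensionalityI[OF assms(3,4)])
  fix p assume "p \<in> points G"
  then consider v where "p = Vertex v" "v \<in> verts G"
    | e x where "p = Inner e x" "e \<in> edges G" "0 < x" "x < len G e"
    unfolding points_def by auto
  then show "u p = w p"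
  proof cases
    case 1
    then show ?thesis using verts by simp
  next
    case (2 e x)
    then have "u p = on_edge G u e x" "w p = on_edge G w e x"
      by (auto simp: on_edge_def edge_point_def)
    then show ?thesis
      using 2 assms(1,2) verts[OF source_in] verts[OF target_in]
      unfolding edgewise_parabolic_def by simp
  qed
qed

end

section \<open>Identification of the torsion function and its rigidity\<close>

context dirichlet_graph
begin

lemma is_torsion_function_iff:
  "is_torsion_function G D u \<longleftrightarrow> edgewise_parabolic G u \<and> discrete_torsion (\<lambda>v. u (Vertex v))"
  unfolding is_torsion_function_def edgewise_parabolic_iff[symmetric] discrete_torsion_def
    vanishes_on_def
  using edgewise_parabolic_imp_continuous[of u] normal_deriv_sum_eq[of u]
  by auto

text \<open>Interpolation reproduces \<open>\<phi>\<close> only on \<open>verts G\<close>; this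
  suffices because edges end in \<open>verts G\<close> and \<open>D\<close> lies in it.\<close>

lemma discrete_torsion_interpolate:
  assumes "discrete_torsion \<phi>"
  shows "discrete_torsion (\<lambda>v. interpolate G \<phi> (Vertex v))"
proof -
  have "dirichlet_form G (\<lambda>v. interpolate G \<phi> (Vertex v)) \<psi> = dirichlet_form G \<phi> \<psi>" for \<psi>
    unfolding dirichlet_form_def
    by (intro sum.cong) (auto simp: interpolate_Vertex source_in target_in)
  then show ?thesis
    using assms D_subset
    by (auto simp: discrete_torsion_def vanishes_on_def interpolate_Vertex subset_iff)
qed

text \<open>Justifies the definite description: interpolating a discrete solution gives existence,
  and uniqueness of vertex values passes to the parabolas.\<close>

lemma torsion_function_spec: "is_torsion_function G D (torsion_function G D)"
proof -
  obtain \<phi> where \<phi>: "discrete_torsion \<phi>"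
    using discrete_torsion_exists by blast
  have "\<exists>!u. u \<in> extensional (points G) \<and> is_torsion_function G D u"
  proof (rule ex1I[of _ "interpolate G \<phi>"])
    show *: "interpolate G \<phi> \<in> extensional (points G) \<and> is_torsion_function G D (interpolate G \<phi>)"
      using \<phi> by (simp add: is_torsion_function_iff edgewise_parabolic_interpolate
          discrete_torsion_interpolate) (simp add: interpolate_def)
    show "u = interpolate G \<phi>" if "u \<in> extensional (points G) \<and> is_torsion_function G D u" for u
      using that * discrete_torsion_unique unfolding is_torsion_function_iff
      by (intro edgewise_parabolic_ext) blast+
  qed
  from theI'[OF this] show ?thesis
    unfolding torsion_function_def by blast
qed

lemma discrete_torsion_vertex_torsion: "discrete_torsion (vertex_torsion G D)"
  using torsion_function_spec unfolding is_torsion_function_iff vertex_torsion_def[abs_def] by blast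

lemma vanishes_on_vertex_torsion: "vanishes_on D (vertex_torsion G D)"
  using discrete_torsion_vertex_torsion by (simp add: discrete_torsion_def)

text \<open>Integrating the parabolas gives the load plus cubic terms; this equals the energy
  because the vertex values solve the discrete equation, not for arbitrary ones.\<close>

lemma torsional_rigidity_eq_energy: "torsional_rigidity G D = energy G (vertex_torsion G D)"
proof -
  let ?\<tau> = "vertex_torsion G D"
  have "integral {0..len G e} (on_edge G (torsion_function G D) e) =
      (?\<tau> (source G e) + ?\<tau> (target G e)) * len G e / 2 + len G e ^ 3 / 12"
    if e: "e \<in> edges G" for e
  proof -
    have "on_edge G (torsion_function G D) e x =
        edge_profile (len G e) (?\<tau> (source G e)) (?\<tau> (target G e)) x" if "x \<in> {0..len G e}" for x
      using torsion_function_spec e that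
      unfolding is_torsion_function_iff edgewise_parabolic_def vertex_torsion_def by blast
    then have "integral {0..len G e} (on_edge G (torsion_function G D) e) =
        integral {0..len G e} (edge_profile (len G e) (?\<tau> (source G e)) (?\<tau> (target G e)))"
      by (rule integral_cong)
    then show ?thesis
      using len_pos[OF e] by (simp add: integral_edge_profile)
  qed
  then have "torsional_rigidity G D = load G ?\<tau> + (\<Sum>e\<in>edges G. len G e ^ 3 / 12)"
    unfolding torsional_rigidity_def graph_integral_def load_def sum.distrib[symmetric]
    by (intro sum.cong) (auto simp: mult.commute)
  then show ?thesis
    using energy_discrete_torsion[OF discrete_torsion_vertex_torsion] by simp
qed

lemma energy_le_torsional_rigidity:
  "vanishes_on D \<eta> \<Longrightarrow> energy G \<eta> \<le> torsional_rigidity G D"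
  unfolding torsional_rigidity_eq_energy by (rule energy_le[OF discrete_torsion_vertex_torsion])

lemma torsional_rigidity_le_energy_imp_eq:
  "\<lbrakk>vanishes_on D \<eta>; torsional_rigidity G D \<le> energy G \<eta>; v \<in> verts G\<rbrakk>
    \<Longrightarrow> \<eta> v = vertex_torsion G D v"
  unfolding torsional_rigidity_eq_energy
  by (rule energy_maximiser_unique[OF discrete_torsion_vertex_torsion])

lemmas vertex_torsion_nonneg = discrete_torsion_nonneg[OF discrete_torsion_vertex_torsion]

lemmas vertex_torsion_pos = discrete_torsion_pos[OF discrete_torsion_vertex_torsion]

end

section \<open>Surgery\<close>

context connected_graph
begin

lemma connected_graph_glue_vertices:
  assumes v: "v \<in> verts G" and w: "w \<in> verts G" and vw: "v \<noteq> w"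
  shows "connected_graph (glue_vertices G v w)"
proof
  show "S = verts (glue_vertices G v w)"
    if S: "S \<subseteq> verts (glue_vertices G v w)" "S \<noteq> {}"
      and closed: "\<And>e. e \<in> edges (glue_vertices G v w) \<Longrightarrow>
        source (glue_vertices G v w) e \<in> S \<longleftrightarrow> target (glue_vertices G v w) e \<in> S" for S
  proof -
    \<comment> \<open>The preimage of \<open>S\<close> under the map that sends \<open>w\<close> to
      \<open>v\<close>.\<close>
    define S' where "S' = (if v \<in> S then insert w S else S)"
    have wS: "w \<notin> S"
      using S by (auto simp: glue_vertices_def)
    have pre: "(if x = w then v else x) \<in> S \<longleftrightarrow> x \<in> S'" for x
      using wS by (auto simp: S'_def)
    have "S' = verts G"
    proof (rule no_separation)
      show "S' \<subseteq> verts G" "S' \<noteq> {}"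
        using S w by (auto simp: S'_def glue_vertices_def)
      show "source G e \<in> S' \<longleftrightarrow> target G e \<in> S'" if "e \<in> edges G" for e
        using closed[of e] that pre[of "source G e"] pre[of "target G e"]
        by (simp add: glue_vertices_def)
    qed
    then show ?thesis
      using v vw wS by (auto simp: S'_def glue_vertices_def split: if_splits)
  qed
qed (use assms finite_verts finite_edges source_in target_in len_pos in
      \<open>auto simp: glue_vertices_def\<close>)

text \<open>Gluing keeps all edges, so functions on the glued graph are those on \<open>G\<close>
  with equal values at \<open>v\<close> and \<open>w\<close>.\<close>

lemma energy_glue_vertices:
  "energy (glue_vertices G v w) \<phi> = energy G (\<lambda>x. \<phi> (if x = w then v else x))"
  unfolding energy_def glue_vertices_def by simp

text \<open>A set that meets one of the two graphs contains it, hence contains the shared vertex,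
  and so meets and contains the other.\<close>

lemma connected_graph_attach_graph:
  assumes H: "connected_graph H" and meet: "verts G \<inter> verts H = {v}"
    and disj: "edges G \<inter> edges H = {}"
  shows "connected_graph (attach_graph G H)"
proof -
  interpret H: connected_graph H by (rule H)
  have notG: "e \<notin> edges G" if "e \<in> edges H" for e
    using that disj by blast
  show ?thesis
  proof
    show "S = verts (attach_graph G H)"
      if S: "S \<subseteq> verts (attach_graph G H)" "S \<noteq> {}"
        and closed: "\<And>e. e \<in> edges (attach_graph G H) \<Longrightarrow>
          source (attach_graph G H) e \<in> S \<longleftrightarrow> target (attach_graph G H) e \<in> S" for S
    proof -
      have "S \<inter> verts G = verts G" if "S \<inter> verts G \<noteq> {}"
      proof (rule no_separation)
        show "source G e \<in> S \<inter> verts G \<longleftrightarrow> target G e \<in> S \<inter> verts G" if "e \<in> edges G" for e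
          using closed[of e] that source_in target_in by (simp add: attach_graph_def)
      qed (use that in auto)
      moreover have "S \<inter> verts H = verts H" if "S \<inter> verts H \<noteq> {}"
      proof (rule H.no_separation)
        show "source H e \<in> S \<inter> verts H \<longleftrightarrow> target H e \<in> S \<inter> verts H" if "e \<in> edges H" for e
          using closed[of e] that notG H.source_in H.target_in by (simp add: attach_graph_def)
      qed (use that in auto)
      ultimately show ?thesis
        using S meet unfolding attach_graph_def by auto
    qed
  qed (use finite_verts finite_edges source_in target_in len_pos H.finite_verts H.finite_edges
        H.source_in H.target_in H.len_pos notG in \<open>auto simp: attach_graph_def\<close>)
qed

lemma connected_graph_add_edge:
  assumes "e \<notin> edges G" "a \<in> verts G" "b \<in> verts G" "0 < l"
  shows "connected_graph (add_edge G e a b l)"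
proof
  show "S = verts (add_edge G e a b l)"
    if S: "S \<subseteq> verts (add_edge G e a b l)" "S \<noteq> {}"
      and closed: "\<And>f. f \<in> edges (add_edge G e a b l) \<Longrightarrow>
        source (add_edge G e a b l) f \<in> S \<longleftrightarrow> target (add_edge G e a b l) f \<in> S" for S
  proof -
    have "S = verts G"
    proof (rule no_separation)
      show "source G f \<in> S \<longleftrightarrow> target G f \<in> S" if "f \<in> edges G" for f
        using closed[of f] that assms(1) by (auto simp: add_edge_def split: if_splits)
    qed (use S in \<open>auto simp: add_edge_def\<close>)
    then show ?thesis
      by (simp add: add_edge_def)
  qed
qed (use assms finite_verts finite_edges source_in target_in len_pos in
      \<open>auto simp: add_edge_def\<close>)

lemma connected_graph_set_edge_length:
  assumes "0 < l"
  shows "connected_graph (set_edge_length G e l)"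
  using assms finite_verts finite_edges source_in target_in len_pos no_separation
  by unfold_locales (auto simp: set_edge_length_def)

lemma connected_graph_scale_graph:
  assumes "0 < c"
  shows "connected_graph (scale_graph c G)"
  using assms finite_verts finite_edges source_in target_in len_pos no_separation
  by unfold_locales (auto simp: scale_graph_def)

text \<open>The factor \<open>c\<^sup>2\<close> on values preserves v'' = -1 when lengths are
  stretched by \<open>c\<close>; each term of the edge energy then gains the cube of
  \<open>c\<close>.\<close>

lemma energy_scale_graph:
  assumes c: "0 < c"
  shows "energy (scale_graph c G) (\<lambda>v. c\<^sup>2 * \<phi> v) = c ^ 3 * energy G \<phi>"
proof -
  have "edge_energy (c * l) (c\<^sup>2 * a) (c\<^sup>2 * b) = c ^ 3 * edge_energy l a b" if "0 < l" for l a b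
    using c that by (simp add: edge_energy_def field_simps power2_eq_square power3_eq_cube)
  then show ?thesis
    unfolding energy_def sum_distrib_left
    by (intro sum.cong) (auto simp: scale_graph_def len_pos)
qed

text \<open>The new edge keeps \<open>v1\<close> and \<open>v2\<close> on the same side, which
  replaces the links lost with \<open>e1\<close> and \<open>e2\<close>. The name \<open>e0\<close>
  may coincide with one of these, so they are treated before any comparison with
  \<open>e0\<close>.\<close>

lemma connected_graph_unfold_parallel:
  assumes e1: "e1 \<in> edges G" "edge_ends G e1 = {v1, v2}"
    and e2: "e2 \<in> edges G" "edge_ends G e2 = {v1, v2}"
    and e0: "e0 \<notin> edges (delete_edges G {e1, e2})" and l: "0 < l"
  shows "connected_graph (add_edge (delete_edges G {e1, e2}) e0 v1 v2 l)" (is "connected_graph ?G")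
proof
  have v: "v1 \<in> verts G" "v2 \<in> verts G"
    using source_in[OF e1(1)] target_in[OF e1(1)] e1(2) by (auto simp: edge_ends_def doubleton_eq_iff)
  show "S = verts ?G"
    if S: "S \<subseteq> verts ?G" "S \<noteq> {}"
      and closed: "\<And>e. e \<in> edges ?G \<Longrightarrow> source ?G e \<in> S \<longleftrightarrow> target ?G e \<in> S" for S
  proof -
    have v12: "v1 \<in> S \<longleftrightarrow> v2 \<in> S"
      using closed[of e0] by (auto simp: add_edge_def)
    have "S = verts G"
    proof (rule no_separation)
      show "source G e \<in> S \<longleftrightarrow> target G e \<in> S" if e: "e \<in> edges G" for e
      proof (cases "e \<in> {e1, e2}")
        case True
        then show ?thesis
          using v12 e1(2) e2(2) by (auto simp: edge_ends_def doubleton_eq_iff)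
      next
        case False
        then have "e \<noteq> e0"
          using e e0 by (auto simp: delete_edges_def)
        then show ?thesis
          using closed[of e] e False by (auto simp: add_edge_def delete_edges_def)
      qed
    qed (use S in \<open>auto simp: add_edge_def delete_edges_def\<close>)
    then show ?thesis
      by (simp add: add_edge_def delete_edges_def)
  qed
  show "finite (verts ?G)" "finite (edges ?G)"
    using finite_verts finite_edges by (auto simp: add_edge_def delete_edges_def)
  show "source ?G e \<in> verts ?G" "target ?G e \<in> verts ?G" "0 < len ?G e" if "e \<in> edges ?G" for e
    using that v l source_in target_in len_pos by (auto simp: add_edge_def delete_edges_def)
qed

end

lemma energy_add_edge:
  assumes "finite (edges G)" "e \<notin> edges G"
  shows "energy (add_edge G e a b l) \<phi> = energy G \<phi> + edge_energy l (\<phi> a) (\<phi> b)"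
proof -
  have "energy (add_edge G e a b l) \<phi> = edge_energy l (\<phi> a) (\<phi> b) +
      (\<Sum>f\<in>edges G. edge_energy (len (add_edge G e a b l) f)
        (\<phi> (source (add_edge G e a b l) f)) (\<phi> (target (add_edge G e a b l) f)))"
    using assms by (simp add: energy_def add_edge_def)
  also have "\<dots> = edge_energy l (\<phi> a) (\<phi> b) + energy G \<phi>"
    using assms(2) unfolding energy_def
    by (intro arg_cong2[where f = "(+)"] sum.cong) (auto simp: add_edge_def)
  finally show ?thesis by simp
qed

lemma edge_energy_const: "edge_energy l a a = 2 * a * l + l ^ 3 / 12"
  by (simp add: edge_energy_def)

lemma edge_energy_commute: "edge_energy l a b = edge_energy l b a"
  by (simp add: edge_energy_def power2_commute add.commute)

text \<open>Strictness comes from the cubic term, so it also covers an edge whose two ends are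
  Dirichlet; the signs of \<open>a\<close> and \<open>b\<close> control the linear term.\<close>

lemma edge_energy_strict_mono:
  assumes "0 < l" "l < l'" "0 \<le> a" "0 \<le> b"
  shows "edge_energy l a b < edge_energy l' a b"
proof -
  have "(a + b) * l \<le> (a + b) * l'"
    using assms by (intro mult_left_mono) auto
  moreover have "l ^ 3 < l' ^ 3"
    using assms by (intro power_strict_mono) auto
  moreover have "(b - a)\<^sup>2 / l' \<le> (b - a)\<^sup>2 / l"
    using assms by (intro divide_left_mono) auto
  ultimately show ?thesis
    by (simp add: edge_energy_def)
qed

text \<open>The linear terms add exactly, the jump penalty shrinks, and the cross terms of the cube
  give a strict gain.\<close>

lemma edge_energy_superadditive:
  assumes "0 < l" "0 < l'"
  shows "edge_energy l a b + edge_energy l' a b < edge_energy (l + l') a b"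
proof -
  have "(l + l') ^ 3 = l ^ 3 + l' ^ 3 + 3 * l * l' * (l + l')"
    by (simp add: power3_eq_cube algebra_simps)
  moreover have "0 < 3 * l * l' * (l + l')"
    using assms by simp
  moreover have "(b - a)\<^sup>2 / (l + l') \<le> (b - a)\<^sup>2 / l"
    using assms by (intro divide_left_mono) auto
  moreover have "0 \<le> (b - a)\<^sup>2 / l'"
    using assms by simp
  moreover have "(a + b) * (l + l') = (a + b) * l + (a + b) * l'"
    by (rule distrib_left)
  ultimately show ?thesis
    by (simp add: edge_energy_def add_divide_distrib)
qed

section \<open>The seven comparisons\<close>

context dirichlet_graph
begin

lemma glue_vertices_torsional_rigidity:
  assumes v: "v \<in> verts G - D" and w: "w \<in> verts G - D" and vw: "v \<noteq> w"
  shows "torsional_rigidity (glue_vertices G v w) D \<le> torsional_rigidity G D"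
    and "torsional_rigidity (glue_vertices G v w) D = torsional_rigidity G D \<longleftrightarrow>
      vertex_torsion G D v = vertex_torsion G D w"
proof -
  interpret glued: connected_graph "glue_vertices G v w"
    using assms by (intro connected_graph_glue_vertices) auto
  interpret glued: dirichlet_graph "glue_vertices G v w" D
    using D_subset D_nonempty w by unfold_locales (auto simp: glue_vertices_def)
  let ?\<tau> = "vertex_torsion G D" and ?\<sigma> = "vertex_torsion (glue_vertices G v w) D"
  let ?\<pi> = "\<lambda>x. if x = w then v else x"
  have \<sigma>: "vanishes_on D (\<lambda>x. ?\<sigma> (?\<pi> x))"
    using glued.vanishes_on_vertex_torsion w by (auto simp: vanishes_on_def)
  have T: "torsional_rigidity (glue_vertices G v w) D = energy G (\<lambda>x. ?\<sigma> (?\<pi> x))"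
    unfolding glued.torsional_rigidity_eq_energy by (rule energy_glue_vertices)
  then show le: "torsional_rigidity (glue_vertices G v w) D \<le> torsional_rigidity G D"
    using energy_le_torsional_rigidity[OF \<sigma>] by simp
  show "torsional_rigidity (glue_vertices G v w) D = torsional_rigidity G D \<longleftrightarrow> ?\<tau> v = ?\<tau> w"
  proof
    assume "torsional_rigidity (glue_vertices G v w) D = torsional_rigidity G D"
    then have "torsional_rigidity G D \<le> energy G (\<lambda>x. ?\<sigma> (?\<pi> x))"
      using T by simp
    \<comment> \<open>The pulled-back function is now a maximiser on \<open>G\<close>, so it is
      \<open>?\<tau>\<close> on the vertices; by construction it agrees at \<open>v\<close> and
      \<open>w\<close>.\<close>
    from torsional_rigidity_le_energy_imp_eq[OF \<sigma> this, of v]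
      torsional_rigidity_le_energy_imp_eq[OF \<sigma> this, of w]
    show "?\<tau> v = ?\<tau> w"
      using v w vw by simp
  next
    assume eq: "?\<tau> v = ?\<tau> w"
    \<comment> \<open>Equal values let \<open>?\<tau>\<close> factor through the gluing, so it is a
      test vector for the glued graph with the same energy.\<close>
    have "(\<lambda>x. ?\<tau> (?\<pi> x)) = ?\<tau>"
      using eq by auto
    then have "torsional_rigidity G D = energy (glue_vertices G v w) ?\<tau>"
      unfolding energy_glue_vertices torsional_rigidity_eq_energy by simp
    also have "\<dots> \<le> torsional_rigidity (glue_vertices G v w) D"
      using vanishes_on_vertex_torsion by (rule glued.energy_le_torsional_rigidity)
    finally show "torsional_rigidity (glue_vertices G v w) D = torsional_rigidity G D"
      using le by simp
  qed
qed

text \<open>Without strict decrease the more constrained solution would be the maximiser for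
  \<open>D\<close> too, and its zero at \<open>v\<close> would contradict positivity.\<close>

lemma insert_dirichlet_torsional_rigidity:
  assumes v: "v \<in> verts G" "v \<notin> D"
  shows "torsional_rigidity G (D \<union> {v}) < torsional_rigidity G D"
proof (rule ccontr)
  interpret more: dirichlet_graph G "D \<union> {v}"
    using D_subset v by unfold_locales auto
  let ?\<sigma> = "vertex_torsion G (D \<union> {v})"
  assume "\<not> ?thesis"
  then have le: "torsional_rigidity G D \<le> energy G ?\<sigma>"
    unfolding more.torsional_rigidity_eq_energy by (simp only: not_less)
  have "vanishes_on D ?\<sigma>" "?\<sigma> v = 0"
    using more.vanishes_on_vertex_torsion by (auto simp: vanishes_on_def)
  then have "vertex_torsion G D v = 0"
    using torsional_rigidity_le_energy_imp_eq[OF _ le] v by metis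
  then show False
    using vertex_torsion_pos[of v] v by simp
qed

text \<open>Extending by the constant value at \<open>v\<close> creates no jump on the pendant,
  whose energy is then nonnegative. A pendant consisting of \<open>v\<close> alone gives
  equality.\<close>

lemma attach_graph_torsional_rigidity:
  assumes v: "v \<in> verts G - D" and H: "pendant_at G H v"
  shows "torsional_rigidity G D \<le> torsional_rigidity (attach_graph G H) D"
proof -
  have meet: "verts G \<inter> verts H = {v}" and disj: "edges G \<inter> edges H = {}"
    using H by (auto simp: pendant_at_def)
  interpret H: connected_graph H
    using H by (simp add: pendant_at_def compact_connected_graph_imp_connected_graph)
  interpret attached: connected_graph "attach_graph G H"
    using H.connected_graph_axioms meet disj by (rule connected_graph_attach_graph)
  interpret attached: dirichlet_graph "attach_graph G H" D
    using D_subset D_nonempty by unfold_locales (auto simp: attach_graph_def)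
  let ?\<tau> = "vertex_torsion G D"
  define \<eta> where "\<eta> x = (if x \<in> verts G then ?\<tau> x else ?\<tau> v)" for x
  have \<eta>H: "\<eta> x = ?\<tau> v" if "x \<in> verts H" for x
    using that meet by (auto simp: \<eta>_def)
  let ?E = "\<lambda>e. edge_energy (len (attach_graph G H) e)
    (\<eta> (source (attach_graph G H) e)) (\<eta> (target (attach_graph G H) e))"
  have "0 \<le> ?E e" if "e \<in> edges H" for e
  proof -
    have "e \<notin> edges G"
      using that disj by blast
    then have "?E e = edge_energy (len H e) (?\<tau> v) (?\<tau> v)"
      using that by (simp add: attach_graph_def \<eta>H H.source_in H.target_in)
    then show ?thesis
      using H.len_pos[OF that] vertex_torsion_nonneg[of v] v by (simp add: edge_energy_const)
  qed
  then have "0 \<le> (\<Sum>e\<in>edges H. ?E e)"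
    by (rule sum_nonneg)
  moreover have "(\<Sum>e\<in>edges G. ?E e) = torsional_rigidity G D"
    unfolding torsional_rigidity_eq_energy energy_def
    by (intro sum.cong) (auto simp: attach_graph_def \<eta>_def source_in target_in)
  moreover have "energy (attach_graph G H) \<eta> = (\<Sum>e\<in>edges G. ?E e) + (\<Sum>e\<in>edges H. ?E e)"
    unfolding energy_def
    by (subst sum.union_disjoint[symmetric])
       (auto simp: finite_edges H.finite_edges disj attach_graph_def)
  moreover have "vanishes_on D \<eta>"
    using vanishes_on_vertex_torsion D_subset by (auto simp: vanishes_on_def \<eta>_def)
  ultimately show ?thesis
    using attached.energy_le_torsional_rigidity[of \<eta>] by linarith
qed

text \<open>With equal end values the new edge pays no jump penalty, and nonnegativity of the
  torsion function makes its energy nonnegative.\<close>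

lemma add_edge_torsional_rigidity:
  assumes e: "e \<notin> edges G" and a: "a \<in> verts G" and b: "b \<in> verts G" and l: "0 < l"
    and eq: "vertex_torsion G D a = vertex_torsion G D b"
  shows "torsional_rigidity G D \<le> torsional_rigidity (add_edge G e a b l) D"
proof -
  interpret added: connected_graph "add_edge G e a b l"
    using e a b l by (rule connected_graph_add_edge)
  interpret added: dirichlet_graph "add_edge G e a b l" D
    using D_subset D_nonempty by unfold_locales (auto simp: add_edge_def)
  have "0 \<le> edge_energy l (vertex_torsion G D a) (vertex_torsion G D b)"
    using l vertex_torsion_nonneg[OF b] by (simp add: eq edge_energy_const)
  then show ?thesis
    using added.energy_le_torsional_rigidity[OF vanishes_on_vertex_torsion]
    by (simp add: energy_add_edge[OF finite_edges e] torsional_rigidity_eq_energy)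
qed

lemma set_edge_length_torsional_rigidity:
  assumes e: "e \<in> edges G" and l: "len G e < l"
  shows "torsional_rigidity G D < torsional_rigidity (set_edge_length G e l) D"
proof -
  have l0: "0 < l"
    using len_pos[OF e] l by linarith
  interpret longer: connected_graph "set_edge_length G e l"
    using l0 by (rule connected_graph_set_edge_length)
  interpret longer: dirichlet_graph "set_edge_length G e l" D
    using D_subset D_nonempty by unfold_locales (auto simp: set_edge_length_def)
  let ?\<tau> = "vertex_torsion G D"
  have less: "edge_energy (len G e) (?\<tau> (source G e)) (?\<tau> (target G e)) <
      edge_energy l (?\<tau> (source G e)) (?\<tau> (target G e))"
    using e l len_pos source_in target_in by (intro edge_energy_strict_mono vertex_torsion_nonneg) auto
  have "torsional_rigidity G D < energy (set_edge_length G e l) ?\<tau>"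
    unfolding torsional_rigidity_eq_energy energy_def set_edge_length_def
    using less e finite_edges by (auto intro!: sum_strict_mono_ex1 simp: less_imp_le)
  also have "\<dots> \<le> torsional_rigidity (set_edge_length G e l) D"
    using vanishes_on_vertex_torsion by (rule longer.energy_le_torsional_rigidity)
  finally show ?thesis .
qed

text \<open>Each maximiser, rescaled by \<open>c\<^sup>2\<close>, is a test vector for the other
  graph.\<close>

lemma scale_graph_torsional_rigidity:
  assumes c: "0 < c"
  shows "torsional_rigidity (scale_graph c G) D = c ^ 3 * torsional_rigidity G D"
proof (rule antisym)
  interpret scaled: connected_graph "scale_graph c G"
    using c by (rule connected_graph_scale_graph)
  interpret scaled: dirichlet_graph "scale_graph c G" D
    using D_subset D_nonempty by unfold_locales (auto simp: scale_graph_def)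
  let ?\<tau> = "vertex_torsion G D" and ?\<sigma> = "vertex_torsion (scale_graph c G) D"
  have "torsional_rigidity (scale_graph c G) D = energy (scale_graph c G) (\<lambda>v. c\<^sup>2 * (?\<sigma> v / c\<^sup>2))"
    using c by (simp add: scaled.torsional_rigidity_eq_energy)
  also have "\<dots> = c ^ 3 * energy G (\<lambda>v. ?\<sigma> v / c\<^sup>2)"
    using c by (rule energy_scale_graph)
  also have "\<dots> \<le> c ^ 3 * torsional_rigidity G D"
    using c scaled.vanishes_on_vertex_torsion
    by (intro mult_left_mono energy_le_torsional_rigidity) (auto simp: vanishes_on_def)
  finally show "torsional_rigidity (scale_graph c G) D \<le> c ^ 3 * torsional_rigidity G D" .
  have "c ^ 3 * torsional_rigidity G D = energy (scale_graph c G) (\<lambda>v. c\<^sup>2 * ?\<tau> v)"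
    using c by (simp add: energy_scale_graph torsional_rigidity_eq_energy)
  also have "\<dots> \<le> torsional_rigidity (scale_graph c G) D"
    using vanishes_on_vertex_torsion
    by (intro scaled.energy_le_torsional_rigidity) (auto simp: vanishes_on_def)
  finally show "c ^ 3 * torsional_rigidity G D \<le> torsional_rigidity (scale_graph c G) D" .
qed

lemma unfold_parallel_torsional_rigidity:
  assumes e1: "e1 \<in> edges G" and e2: "e2 \<in> edges G" and ne: "e1 \<noteq> e2"
    and ends1: "edge_ends G e1 = {v1, v2}" and ends2: "edge_ends G e2 = {v1, v2}"
    and e0: "e0 \<notin> edges (delete_edges G {e1, e2})"
  shows "torsional_rigidity G D <
    torsional_rigidity (add_edge (delete_edges G {e1, e2}) e0 v1 v2 (len G e1 + len G e2)) D"
    (is "_ < torsional_rigidity ?G D")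
proof -
  interpret unfolded: connected_graph ?G
    using e1 ends1 e2 ends2 e0 add_pos_pos[OF len_pos[OF e1] len_pos[OF e2]]
    by (rule connected_graph_unfold_parallel)
  interpret unfolded: dirichlet_graph ?G D
    using D_subset D_nonempty by unfold_locales (auto simp: add_edge_def delete_edges_def)
  let ?\<tau> = "vertex_torsion G D"
  let ?E = "\<lambda>e. edge_energy (len G e) (?\<tau> (source G e)) (?\<tau> (target G e))"
  \<comment> \<open>The parallel edges may be oriented oppositely; symmetry of the edge energy
    brings both to the order \<open>v1\<close>, \<open>v2\<close>.\<close>
  have E: "?E e = edge_energy (len G e) (?\<tau> v1) (?\<tau> v2)" if "edge_ends G e = {v1, v2}" for e
    using that edge_energy_commute by (auto simp: edge_ends_def doubleton_eq_iff)
  have "torsional_rigidity G D = ?E e1 + (?E e2 + (\<Sum>e\<in>edges G - {e1} - {e2}. ?E e))"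
    unfolding torsional_rigidity_eq_energy energy_def
    using e1 e2 ne finite_edges
    by (simp add: sum.remove[of "edges G" e1] sum.remove[of "edges G - {e1}" e2])
  also have "\<dots> = ?E e1 + ?E e2 + energy (delete_edges G {e1, e2}) ?\<tau>"
    by (simp add: energy_def delete_edges_def Diff_insert2[symmetric] insert_commute)
  also have "\<dots> < energy (delete_edges G {e1, e2}) ?\<tau> +
      edge_energy (len G e1 + len G e2) (?\<tau> v1) (?\<tau> v2)"
    unfolding E[OF ends1] E[OF ends2]
    using edge_energy_superadditive[OF len_pos[OF e1] len_pos[OF e2], of "?\<tau> v1" "?\<tau> v2"] by linarith
  also have "\<dots> = energy ?G ?\<tau>"
    using e0 finite_edges by (intro energy_add_edge[symmetric]) (auto simp: delete_edges_def)
  also have "\<dots> \<le> torsional_rigidity ?G D"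
    using vanishes_on_vertex_torsion by (rule unfolded.energy_le_torsional_rigidity)
  finally show ?thesis .
qed

end

theorem proposition4p1:
  fixes G :: "('v, 'e) metric_graph" and D :: "'v set"
  assumes "compact_connected_graph G"
    and "D \<subseteq> verts G"
    and "D \<noteq> {}"
  shows
    "(\<forall>v w. v \<in> verts G - D \<and> w \<in> verts G - D \<and> v \<noteq> w \<longrightarrow>
        torsional_rigidity (glue_vertices G v w) D \<le> torsional_rigidity G D \<and>
        (torsional_rigidity (glue_vertices G v w) D = torsional_rigidity G D \<longleftrightarrow>
           torsion_function G D (Vertex v) = torsion_function G D (Vertex w)))
   \<and> (\<forall>v. v \<in> verts G \<and> v \<notin> D \<longrightarrow>
        torsional_rigidity G (D \<union> {v}) < torsional_rigidity G D)
   \<and> (\<forall>H v. v \<in> verts G - D \<and> pendant_at G H v \<longrightarrow>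
        torsional_rigidity G D \<le> torsional_rigidity (attach_graph G H) D)
   \<and> (\<forall>e v' v'' l. e \<notin> edges G \<and> v' \<in> verts G \<and> v'' \<in> verts G \<and> 0 < l \<and>
          torsion_function G D (Vertex v') = torsion_function G D (Vertex v'') \<longrightarrow>
        torsional_rigidity G D \<le> torsional_rigidity (add_edge G e v' v'' l) D)
   \<and> (\<forall>e l. e \<in> edges G \<and> len G e < l \<longrightarrow>
        torsional_rigidity G D < torsional_rigidity (set_edge_length G e l) D)
   \<and> (\<forall>c. 0 < c \<longrightarrow>
        torsional_rigidity G D = c powi (- 3) * torsional_rigidity (scale_graph c G) D)
   \<and> (\<forall>e1 e2 e0 v1 v2. e1 \<in> edges G \<and> e2 \<in> edges G \<and> e1 \<noteq> e2 \<and>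
          edge_ends G e1 = {v1, v2} \<and> edge_ends G e2 = {v1, v2} \<and>
          e0 \<notin> edges (delete_edges G {e1, e2}) \<longrightarrow>
        torsional_rigidity
          (add_edge (delete_edges G {e1, e2}) e0 v1 v2 (len G e1 + len G e2)) D
        > torsional_rigidity G D)"
proof -
  interpret connected_graph G
    using assms(1) by (rule compact_connected_graph_imp_connected_graph)
  interpret dirichlet_graph G D
    using assms(2,3) by unfold_locales
  have scale: "torsional_rigidity G D = c powi (- 3) * torsional_rigidity (scale_graph c G) D"
    if "0 < c" for c
    using that by (simp add: scale_graph_torsional_rigidity power_int_minus)
  show ?thesis
    \<comment> \<open>Folds the torsion values at vertices into the form used by the comparison
      lemmas.\<close>
    unfolding vertex_torsion_def[symmetric]
    by (intro conjI allI impI; (elim conjE)?)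
       (assumption | rule glue_vertices_torsional_rigidity insert_dirichlet_torsional_rigidity
          attach_graph_torsional_rigidity add_edge_torsional_rigidity
          set_edge_length_torsional_rigidity scale unfold_parallel_torsional_rigidity)+
qed

end
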